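(* Let $V$ be a finite dimensional subspace of the complex vector space of complex sequences $y=(y_n)_{n\in\mathbb{N}}$. Then $V$ is invariant under every linear finite difference operator if and only if there exist $\lambda_i\in\mathbb{C}$ and positive integers $l_i$, $i=1,\dots,s$, such that $$V=\bigoplus_{i=1}^{s} G_{\lambda_i,l_i}.$$
   Context: The shift operator $S$ acts on complex sequences $y=(y_n)_{n\in\mathbb{N}}$ by $(Sy)_n=y_{n+1}$. A linear finite difference operator on complex sequences is a polynomial in $S$ (with complex coefficients). For an integer $m\ge 0$, $\Pi_m$ denotes the set of complex polynomials of degree at most $m$. For $\lambda\in\mathbb{C}$ and an integer $m>0$, $$G_{\lambda,m}=\{(\lambda^n p(n))_{n\in\mathbb{N}} : p\in\Pi_{m-1}\},$$ a subspace of the space of complex sequences. A subspace $V$ is invariant under an operator $T$ if $T(V)\subseteq V$. The symbol $\bigoplus$ denotes an internal direct sum of subspaces of the space of complex sequences.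
   Formalization: For λ=0 the space G_{0,m} is taken to be all sequences vanishing from index m on, instead of {0^n p(n)}; with the literal formula the claim fails, e.g. for V = span(e_0,e_1) = ker S^2, which is invariant but not such a direct sum. *)

theory Defs
  imports
    "HOL-Analysis.Analysis"
    "HOL-Library.Function_Algebras"
    "HOL-Computational_Algebra.Polynomial"
begin

type_synonym cseq = "nat \<Rightarrow> complex"

definition cscale :: "complex \<Rightarrow> cseq \<Rightarrow> cseq"
  where "cscale c y = (\<lambda>n. c * y n)"

interpretation cseq: vector_space cscale
  by unfold_locales (auto simp: cscale_def algebra_simps)

definition fin_dim :: "cseq set \<Rightarrow> bool"
  where "fin_dim V \<longleftrightarrow> (\<exists>B. finite B \<and> B \<subseteq> V \<and> V \<subseteq> cseq.span B)"

definition shift :: "cseq \<Rightarrow> cseq"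
  where "shift y = (\<lambda>n. y (Suc n))"

definition poly_shift :: "complex poly \<Rightarrow> cseq \<Rightarrow> cseq"
  where "poly_shift p y = (\<Sum>k\<le>degree p. cscale (coeff p k) ((shift ^^ k) y))"

definition finite_difference_operator :: "(cseq \<Rightarrow> cseq) \<Rightarrow> bool"
  where "finite_difference_operator T \<longleftrightarrow> (\<exists>p. T = poly_shift p)"

definition invariant_under :: "(cseq \<Rightarrow> cseq) \<Rightarrow> cseq set \<Rightarrow> bool"
  where "invariant_under T V \<longleftrightarrow> T ` V \<subseteq> V"

definition poly_le :: "nat \<Rightarrow> complex poly set"
  where "poly_le m = {p. degree p \<le> m}"

definition exp_poly_space :: "complex \<Rightarrow> nat \<Rightarrow> cseq set"
  where "exp_poly_space lam m = {(\<lambda>n. lam ^ n * poly p (of_nat n)) | p. p \<in> poly_le (m - 1)}"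

text \<open>
  For a nonzero parameter, \<open>G lam m\<close> is the space of all sequences \<open>lam ^ n * p n\<close> with
  \<open>p\<close> of degree less than \<open>m\<close>.  At \<open>lam = 0\<close> that formula degenerates to multiples of the
  single sequence \<open>(1, 0, 0, \<dots>)\<close>, whatever \<open>m\<close> is, and the characterisation of the invariant
  subspaces fails; see \<open>exp_poly_space_decomposition_fails\<close> below.  The convention
  for \<open>lam = 0\<close> is therefore the space of sequences vanishing from index \<open>m\<close> on.  It is the limit
  of \<open>exp_poly_space lam m\<close> as \<open>lam\<close> tends to 0 (use the basis
  \<open>(n choose k) * lam ^ (n - k)\<close>, \<open>k < m\<close>), and it agrees with the formula for \<open>m = 1\<close>.
\<close>

definition G :: "complex \<Rightarrow> nat \<Rightarrow> cseq set"
  where "G lam m = (if lam = 0 then {y. \<forall>n\<ge>m. y n = 0} else exp_poly_space lam m)"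

text \<open>
  The components are indexed, so a nonzero space occurring twice is not a direct sum; an empty
  index set gives the zero space.
\<close>

definition is_direct_sum :: "'i set \<Rightarrow> ('i \<Rightarrow> cseq set) \<Rightarrow> cseq set \<Rightarrow> bool"
  where "is_direct_sum I W V \<longleftrightarrow>
    V = {(\<Sum>i\<in>I. w i) | w. \<forall>i\<in>I. w i \<in> W i} \<and>
    (\<forall>w. (\<forall>i\<in>I. w i \<in> W i) \<and> (\<Sum>i\<in>I. w i) = 0 \<longrightarrow> (\<forall>i\<in>I. w i = 0))"

lemma sum_cseq_apply: "(\<Sum>i\<in>I. (w i :: cseq)) n = (\<Sum>i\<in>I. w i n)"
  by (induction I rule: infinite_finite_induct) auto

lemma funpow_shift: "(shift ^^ k) y = (\<lambda>n. y (n + k))"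
  by (induction k) (auto simp: shift_def)

lemma G_eq_exp_poly_space: "lam \<noteq> 0 \<Longrightarrow> G lam m = exp_poly_space lam m"
  by (simp add: G_def)

lemma G_zero_one: "G 0 1 = exp_poly_space 0 1"
proof -
  have "(\<lambda>n. 0 ^ n * y 0) = y" if "\<forall>n\<ge>1. y n = 0" for y :: cseq
    using that by (auto simp: fun_eq_iff power_0_left)
  then have "y \<in> exp_poly_space 0 1" if "\<forall>n\<ge>1. y n = 0" for y :: cseq
    using that unfolding exp_poly_space_def poly_le_def
    by (intro CollectI exI[of _ "[:y 0:]"]) auto
  then show ?thesis
    by (auto simp: G_def exp_poly_space_def)
qed

lemma exp_poly_space_decomposition_fails:
  defines "V \<equiv> {y :: cseq. \<forall>n\<ge>2. y n = 0}"
  shows "cseq.subspace V" "fin_dim V"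
    "\<forall>T. finite_difference_operator T \<longrightarrow> invariant_under T V"
    "\<not> (\<exists>s lam l. (\<forall>i\<in>{1..s::nat}. 0 < l i) \<and>
           is_direct_sum {1..s} (\<lambda>i. exp_poly_space (lam i) (l i)) V)"
proof -
  show sub: "cseq.subspace V"
    by (auto simp: V_def cseq.subspace_def cscale_def)
  define e :: "nat \<Rightarrow> cseq" where "e k = (\<lambda>n. if n = k then 1 else 0)" for k
  have eV: "e 0 \<in> V" "e 1 \<in> V"
    by (auto simp: e_def V_def)
  show "fin_dim V"
    unfolding fin_dim_def
  proof (intro exI conjI subsetI)
    fix y assume "y \<in> V"
    then have "y = cscale (y 0) (e 0) + cscale (y 1) (e 1)"
      by (auto simp: V_def e_def cscale_def fun_eq_iff)
    also have "\<dots> \<in> cseq.span {e 0, e 1}"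
      by (intro cseq.span_add cseq.span_scale cseq.span_base) auto
    finally show "y \<in> cseq.span {e 0, e 1}" .
  qed (use eV in auto)
  show "\<forall>T. finite_difference_operator T \<longrightarrow> invariant_under T V"
    by (auto simp: finite_difference_operator_def invariant_under_def poly_shift_def V_def
        funpow_shift sum_cseq_apply cscale_def intro!: sum.neutral)
  show "\<not> (\<exists>s lam l. (\<forall>i\<in>{1..s::nat}. 0 < l i) \<and>
           is_direct_sum {1..s} (\<lambda>i. exp_poly_space (lam i) (l i)) V)"
  proof
    assume "\<exists>s lam l. (\<forall>i\<in>{1..s::nat}. 0 < l i) \<and>
           is_direct_sum {1..s} (\<lambda>i. exp_poly_space (lam i) (l i)) V"
    then obtain s :: nat and lam :: "nat \<Rightarrow> complex" and l :: "nat \<Rightarrow> nat" where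
      V: "V = {(\<Sum>i\<in>{1..s}. w i) | w. \<forall>i\<in>{1..s}. w i \<in> exp_poly_space (lam i) (l i)}"
      by (auto simp: is_direct_sum_def)
    have lam0: "lam i = 0" if i: "i \<in> {1..s}" for i
    proof -
      define y :: cseq where "y = (\<lambda>n. lam i ^ n)"
      define w :: "nat \<Rightarrow> cseq" where "w j = (if j = i then y else 0)" for j
      have "(\<lambda>n. c ^ n * poly [:b:] (of_nat n)) \<in> exp_poly_space c m" for b c m
        unfolding exp_poly_space_def poly_le_def
        by (intro CollectI exI[of _ "[:b:]"]) auto
      from this[of _ 1] this[of _ 0] have "\<forall>j\<in>{1..s}. w j \<in> exp_poly_space (lam j) (l j)"
        by (auto simp: w_def y_def zero_fun_def)
      then have "(\<Sum>j\<in>{1..s}. w j) \<in> V"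
        unfolding V by blast
      moreover have "(\<Sum>j\<in>{1..s}. w j) = y"
        using i by (simp add: w_def)
      ultimately show ?thesis
        by (auto simp: V_def y_def)
    qed
    from eV(2) obtain w where w: "e 1 = (\<Sum>i\<in>{1..s}. w i)"
        "\<forall>i\<in>{1..s}. w i \<in> exp_poly_space (lam i) (l i)"
      unfolding V by blast
    have "w i 1 = 0" if "i \<in> {1..s}" for i
    proof -
      have "w i \<in> exp_poly_space 0 (l i)"
        using w(2) lam0[OF that] that by metis
      then show ?thesis
        by (auto simp: exp_poly_space_def)
    qed
    then have "(\<Sum>i\<in>{1..s}. w i) 1 = 0"
      by (simp add: sum_cseq_apply)
    with w(1) show False
      by (metis e_def zero_neq_one)
  qed
qed

end

theory Submission
  imports
    Defs
    "HOL-Computational_Algebra.Field_as_Ring"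
    "HOL-Computational_Algebra.Polynomial_Factorial"
    "HOL-Computational_Algebra.Fundamental_Theorem_Algebra"
begin

text \<open>
  The finite-dimensional shift-invariant spaces are exactly the solution spaces of homogeneous
  linear recurrences with constant coefficients, that is, the kernels of \<open>p(S)\<close> for monic
  polynomials \<open>p\<close>; for \<open>m > 0\<close> the space \<open>G lam m\<close> is the kernel of \<open>(S - lam) ^ m\<close>, and factoring
  \<open>p\<close> into linear factors splits the kernel of \<open>p(S)\<close> into these.

  For the first point, evaluate the sequences of \<open>V\<close> at the indices below \<open>d\<close>, where \<open>d\<close> is the
  least number for which these values determine the sequence.  Minimality of \<open>d\<close> and shift
  invariance make every choice of \<open>d\<close> initial values occur in \<open>V\<close>: if all sequences of \<open>V\<close>
  that vanish below some \<open>j < d\<close> also vanished at \<open>j\<close>, then so would their shifts, so these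
  sequences would be zero and \<open>j\<close> values would suffice.  Now \<open>y d\<close> is a fixed linear combination
  of \<open>y 0, \<dots>, y (d - 1)\<close> for \<open>y \<in> V\<close>, and applying this to all shifts of \<open>y\<close> gives a
  recurrence of order \<open>d\<close>.  A solution of it is determined by its first \<open>d\<close> values, and \<open>V\<close>
  already has a member with these values, so \<open>V\<close> is the whole solution space
  (\<open>shift_invariant_eq_recurrence_space\<close>).

  The same comparison of initial values identifies \<open>G lam m\<close> (\<open>G_eq_recurrence_space\<close>); there the
  interpolating members for nonzero \<open>lam\<close> are Newton polynomials times \<open>lam ^ n\<close>.  The splitting of the kernel is
  the usual consequence of Bezout's identity (\<open>recurrence_space_prod_direct_sum\<close>).  Conversely,
  kernels of polynomials in \<open>S\<close> are invariant because such polynomials commute, hence so is any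
  sum of spaces \<open>G lam m\<close>.
\<close>

section \<open>Polynomials in the shift\<close>

lemma poly_shift_apply: "poly_shift p y n = (\<Sum>k\<le>degree p. coeff p k * y (n + k))"
  by (simp add: poly_shift_def sum_cseq_apply funpow_shift cscale_def)

lemma poly_shift_0_left [simp]: "poly_shift 0 y = 0"
  by (simp add: fun_eq_iff poly_shift_apply)

text \<open>
  The Horner step.  It makes all algebraic identities below accessible to induction on the
  polynomial, where the sum up to the degree would require care with cancelling leading terms.
\<close>

lemma poly_shift_pCons: "poly_shift (pCons a p) y n = a * y n + poly_shift p y (Suc n)"
proof (cases "p = 0")
  case False
  then show ?thesis
    by (simp add: poly_shift_apply sum.atMost_Suc_shift del: sum.atMost_Suc)
qed (simp add: poly_shift_apply)

lemma poly_shift_1 [simp]: "poly_shift 1 y = y"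
  by (simp add: fun_eq_iff one_pCons poly_shift_pCons)

lemma poly_shift_add: "poly_shift (p + q) y n = poly_shift p y n + poly_shift q y n"
  by (induction p q arbitrary: n rule: poly_induct2) (simp_all add: poly_shift_pCons algebra_simps)

lemma poly_shift_smult: "poly_shift (smult c p) y n = c * poly_shift p y n"
  by (induction p arbitrary: n) (simp_all add: poly_shift_pCons algebra_simps)

lemma poly_shift_mult: "poly_shift (p * q) y = poly_shift p (poly_shift q y)"
proof -
  have "poly_shift (p * q) y n = poly_shift p (poly_shift q y) n" for n
    by (induction p arbitrary: n)
      (simp_all add: mult_pCons_left poly_shift_add poly_shift_smult poly_shift_pCons)
  then show ?thesis
    by blast
qed

lemma poly_shift_add_right: "poly_shift p (y + z) = poly_shift p y + poly_shift p z"
  by (simp add: fun_eq_iff poly_shift_apply sum.distrib algebra_simps)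

lemma poly_shift_diff_right: "poly_shift p (y - z) = poly_shift p y - poly_shift p z"
  by (simp add: fun_eq_iff poly_shift_apply sum_subtractf algebra_simps)

lemma poly_shift_0_right [simp]: "poly_shift p 0 = 0"
  by (simp add: fun_eq_iff poly_shift_apply)

lemma poly_shift_sum_right: "poly_shift p (\<Sum>i\<in>I. w i) = (\<Sum>i\<in>I. poly_shift p (w i))"
  by (induction I rule: infinite_finite_induct)
    (simp_all only: sum.infinite sum.empty sum.insert poly_shift_add_right poly_shift_0_right
      not_False_eq_True)

definition recurrence_space :: "complex poly \<Rightarrow> cseq set"
  where "recurrence_space p = {y. poly_shift p y = 0}"

lemma recurrence_space_invariant:
  assumes "y \<in> recurrence_space p"
  shows "poly_shift q y \<in> recurrence_space p"
proof -
  have "poly_shift p (poly_shift q y) = poly_shift q (poly_shift p y)"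
    by (metis mult.commute poly_shift_mult)
  with assms show ?thesis
    by (simp add: recurrence_space_def)
qed

lemma recurrence_space_mono:
  assumes "p dvd q"
  shows "recurrence_space p \<subseteq> recurrence_space q"
  using assms by (auto simp: recurrence_space_def poly_shift_mult mult.commute[of p] elim!: dvdE)

section \<open>Sequences determined by initial values\<close>

text \<open>
  Since the leading coefficient is nonzero, the recurrence can be solved for the last of any
  \<open>degree p + 1\<close> consecutive terms.
\<close>

lemma recurrence_solution_unique:
  assumes "p \<noteq> 0" and y: "y \<in> recurrence_space p" and init: "\<And>i. i < degree p \<Longrightarrow> y i = 0"
  shows "y = 0"
proof -
  have "y n = 0" for n
  proof (induction n rule: less_induct)
    case (less n)
    show ?case
    proof (cases "n < degree p")
      case False
      define m where "m = n - degree p"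
      have n: "n = m + degree p"
        using False by (simp add: m_def)
      have "(\<Sum>k<degree p. coeff p k * y (m + k)) = 0"
        using less n by (intro sum.neutral) auto
      moreover have "poly_shift p y m = 0"
        using y by (simp add: recurrence_space_def)
      ultimately have "lead_coeff p * y n = 0"
        by (simp add: poly_shift_apply n lessThan_Suc_atMost[symmetric])
      then show ?thesis
        using \<open>p \<noteq> 0\<close> by simp
    qed (use init in auto)
  qed
  then show ?thesis
    by (simp add: fun_eq_iff)
qed

text \<open>
  A lower triangular system with nonzero diagonal can be solved: each new prescribed value is
  attained by adding a multiple of a sequence that leaves the earlier values alone.
\<close>

lemma initial_values_surjective:
  assumes W: "cseq.subspace W"
    and echelon: "\<And>j. j < d \<Longrightarrow> \<exists>v\<in>W. (\<forall>i<j. v i = 0) \<and> v j \<noteq> 0"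
  shows "\<exists>y\<in>W. \<forall>i<d. y i = a i"
  using echelon
proof (induction d)
  case 0
  then show ?case
    using cseq.subspace_0[OF W] by auto
next
  case (Suc d)
  then obtain y where y: "y \<in> W" "\<forall>i<d. y i = a i"
    by (meson less_Suc_eq)
  obtain v where v: "v \<in> W" "\<forall>i<d. v i = 0" "v d \<noteq> 0"
    using Suc.prems by blast
  let ?z = "y + cscale ((a d - y d) / v d) v"
  have "?z \<in> W"
    using y(1) v(1) W by (intro cseq.subspace_add cseq.subspace_scale)
  moreover have "\<forall>i<Suc d. ?z i = a i"
    using y(2) v(2,3) by (simp add: cscale_def less_Suc_eq)
  ultimately show ?case
    by blast
qed

text \<open>
  This replaces a dimension count.  The echelon condition says that \<open>W\<close> has at least dimension
  \<open>degree p\<close>, while the solution space has at most this dimension.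
\<close>

lemma subspace_eq_recurrence_space:
  assumes "p \<noteq> 0" and W: "cseq.subspace W" and sub: "W \<subseteq> recurrence_space p"
    and echelon: "\<And>j. j < degree p \<Longrightarrow> \<exists>v\<in>W. (\<forall>i<j. v i = 0) \<and> v j \<noteq> 0"
  shows "W = recurrence_space p"
proof
  show "recurrence_space p \<subseteq> W"
  proof
    fix y assume y: "y \<in> recurrence_space p"
    obtain w where w: "w \<in> W" "\<forall>i<degree p. w i = y i"
      using initial_values_surjective[OF W echelon] by blast
    have "y - w = 0"
    proof (rule recurrence_solution_unique[OF \<open>p \<noteq> 0\<close>])
      show "y - w \<in> recurrence_space p"
        using y w(1) sub by (auto simp: recurrence_space_def poly_shift_diff_right)
    qed (use w(2) in auto)
    with w(1) show "y \<in> W"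
      by simp
  qed
qed (rule sub)

section \<open>The spaces G as solution spaces\<close>

lemma degree_forward_difference_less:
  fixes p :: "complex poly"
  assumes "degree p \<noteq> 0"
  shows "degree (pcompose p [:1, 1:] - p) < degree p"
proof -
  let ?q = "pcompose p [:1, 1:] - p"
  have "degree ?q \<le> degree p"
    by (rule degree_diff_le) (auto simp: degree_pcompose)
  moreover have "coeff ?q (degree p) = 0"
    using lead_coeff_comp[of "[:1, 1:]" p] by (simp add: degree_pcompose)
  ultimately show ?thesis
    using assms by (metis degree_0 eq_zero_or_degree_less bot_nat_0.not_eq_extremum)
qed

text \<open>
  On sequences \<open>lam ^ n * p n\<close> the operator \<open>S - lam\<close> acts as \<open>lam\<close> times the forward difference
  of \<open>p\<close>, so every application lowers the degree.
\<close>

lemma exp_poly_in_recurrence_space: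
  assumes "degree p < m"
  shows "(\<lambda>n. lam ^ n * poly p (of_nat n)) \<in> recurrence_space ([:- lam, 1:] ^ m)"
  using assms
proof (induction m arbitrary: p)
  case (Suc m)
  let ?e = "\<lambda>p n. lam ^ n * poly p (of_nat n)"
  let ?q = "smult lam (pcompose p [:1, 1:] - p)"
  have step: "poly_shift [:- lam, 1:] (?e p) = ?e ?q"
    by (simp add: fun_eq_iff poly_shift_pCons poly_pcompose algebra_simps)
  have "poly_shift ([:- lam, 1:] ^ m) (?e ?q) = 0"
  proof (cases "degree p = 0")
    case True
    then obtain c where "p = [:c:]"
      by (rule degree_eq_zeroE)
    then have "?e ?q = 0"
      by (simp add: fun_eq_iff)
    then show ?thesis
      by simp
  next
    case False
    then have "degree ?q < m"
      using degree_forward_difference_less[OF False] Suc.prems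
      by (metis degree_smult_le less_Suc_eq_le order.strict_trans1 order.strict_trans2)
    then show ?thesis
      using Suc.IH[of ?q] by (simp only: recurrence_space_def mem_Collect_eq)
  qed
  then show ?case
    by (simp only: recurrence_space_def mem_Collect_eq power_Suc2 poly_shift_mult step)
qed simp

lemma subspace_exp_poly_space: "cseq.subspace (exp_poly_space lam m)"
proof -
  have "(\<lambda>n. lam ^ n * poly p (of_nat n)) \<in> exp_poly_space lam m" if "degree p \<le> m - 1" for p
    using that by (auto simp: exp_poly_space_def poly_le_def)
  note I = this
  show ?thesis
    unfolding cseq.subspace_def
  proof (intro conjI ballI allI)
    show "0 \<in> exp_poly_space lam m"
      using I[of 0] by (simp add: zero_fun_def)
  next
    fix x y assume "x \<in> exp_poly_space lam m" "y \<in> exp_poly_space lam m"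
    then obtain p q where "degree p \<le> m - 1" "degree q \<le> m - 1"
      and xy: "x = (\<lambda>n. lam ^ n * poly p (of_nat n))" "y = (\<lambda>n. lam ^ n * poly q (of_nat n))"
      by (auto simp: exp_poly_space_def poly_le_def)
    then have "degree (p + q) \<le> m - 1"
      by (intro degree_add_le)
    moreover have "x + y = (\<lambda>n. lam ^ n * poly (p + q) (of_nat n))"
      by (simp add: xy fun_eq_iff algebra_simps)
    ultimately show "x + y \<in> exp_poly_space lam m"
      using I by metis
  next
    fix c x assume "x \<in> exp_poly_space lam m"
    then obtain p where "degree p \<le> m - 1" and x: "x = (\<lambda>n. lam ^ n * poly p (of_nat n))"
      by (auto simp: exp_poly_space_def poly_le_def)
    then have "degree (smult c p) \<le> m - 1"
      by (meson degree_smult_le order.trans)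
    moreover have "cscale c x = (\<lambda>n. lam ^ n * poly (smult c p) (of_nat n))"
      by (simp add: x fun_eq_iff cscale_def)
    ultimately show "cscale c x \<in> exp_poly_space lam m"
      using I by metis
  qed
qed

lemma exp_poly_space_eq_recurrence_space:
  assumes "lam \<noteq> 0" "0 < m"
  shows "exp_poly_space lam m = recurrence_space ([:- lam, 1:] ^ m)"
proof (rule subspace_eq_recurrence_space)
  show "exp_poly_space lam m \<subseteq> recurrence_space ([:- lam, 1:] ^ m)"
    using assms(2) by (auto simp: exp_poly_space_def poly_le_def intro!: exp_poly_in_recurrence_space)
  fix j assume "j < degree ([:- lam, 1:] ^ m)"
  then have "j < m"
    by (simp only: degree_linear_power)
  \<comment> \<open>The Newton polynomial vanishes at all natural numbers below \<open>j\<close>, but not at \<open>j\<close>.\<close>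
  define p :: "complex poly" where "p = (\<Prod>i<j. [:- of_nat i, 1:])"
  have "degree p = j"
    unfolding p_def by (subst degree_prod_eq_sum_degree) auto
  then have "(\<lambda>n. lam ^ n * poly p (of_nat n)) \<in> exp_poly_space lam m"
    using \<open>j < m\<close> by (auto simp: exp_poly_space_def poly_le_def)
  moreover have "\<forall>i<j. lam ^ i * poly p (of_nat i) = 0" "lam ^ j * poly p (of_nat j) \<noteq> 0"
    using \<open>lam \<noteq> 0\<close> by (auto simp: p_def poly_prod)
  ultimately show "\<exists>v\<in>exp_poly_space lam m. (\<forall>i<j. v i = 0) \<and> v j \<noteq> 0"
    by (intro bexI[where x = "\<lambda>n. lam ^ n * poly p (of_nat n)"]) auto
qed (auto simp: subspace_exp_poly_space)

lemma poly_shift_monom: "poly_shift (monom 1 m) y n = y (n + m)"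
  by (induction m arbitrary: n) (simp_all add: monom_0 monom_Suc poly_shift_pCons)

lemma G_eq_recurrence_space:
  assumes "0 < m"
  shows "G lam m = recurrence_space ([:- lam, 1:] ^ m)"
proof (cases "lam = 0")
  case True
  have "[:0, 1::complex:] ^ m = monom 1 m"
    by (simp add: monom_altdef)
  then have "recurrence_space ([:- lam, 1:] ^ m) = {y. \<forall>n. y (n + m) = 0}"
    by (simp add: True recurrence_space_def fun_eq_iff poly_shift_monom)
  also have "\<dots> = G lam m"
    by (auto simp: True G_def) (metis le_add_diff_inverse2)
  finally show ?thesis ..
qed (simp add: G_eq_exp_poly_space exp_poly_space_eq_recurrence_space assms)

section \<open>Primary decomposition of solution spaces\<close>

lemma coprime_linear_powers:
  fixes a b :: complex
  assumes "a \<noteq> b"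
  shows "coprime ([:- a, 1:] ^ k) ([:- b, 1:] ^ l)"
proof -
  have "coprime [:- a, 1:] [:- b, 1:]"
  proof (rule coprimeI)
    fix c assume "c dvd [:- a, 1:]" "c dvd [:- b, 1:]"
    then have "c dvd [:- a, 1:] - [:- b, 1:]"
      by (rule dvd_diff)
    then have "c dvd [:b - a:]"
      by simp
    moreover have "[:b - a:] dvd 1"
      using assms by (simp add: is_unit_const_poly_iff dvd_field_iff)
    ultimately show "is_unit c"
      by (rule dvd_trans)
  qed
  then show ?thesis
    by simp
qed

text \<open>
  Split off one factor at a time.  Let \<open>h\<close> be the product of the factors already treated.  Bezout's
  identity \<open>u * f a + v * h = 1\<close> writes every \<open>y\<close> as \<open>v(S) h(S) y + u(S) (f a)(S) y\<close>.  If
  \<open>f a * h\<close> annihilates \<open>y\<close>, the first summand is annihilated by \<open>f a\<close> and the second by \<open>h\<close>; if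
  both \<open>f a\<close> and \<open>h\<close> annihilate \<open>y\<close>, both summands vanish, which makes the sum direct.
\<close>

lemma recurrence_space_prod_direct_sum:
  fixes f :: "'i \<Rightarrow> complex poly"
  assumes "finite A" "\<And>i j. i \<in> A \<Longrightarrow> j \<in> A \<Longrightarrow> i \<noteq> j \<Longrightarrow> coprime (f i) (f j)"
  shows "is_direct_sum A (\<lambda>i. recurrence_space (f i)) (recurrence_space (\<Prod>i\<in>A. f i))"
  using assms
proof (induction A rule: finite_induct)
  case empty
  then show ?case
    by (auto simp: is_direct_sum_def recurrence_space_def)
next
  case (insert a A)
  define h where "h = (\<Prod>i\<in>A. f i)"
  let ?R = "\<lambda>i. recurrence_space (f i)"
  have IH: "is_direct_sum A ?R (recurrence_space h)"
    unfolding h_def using insert by auto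
  have prod: "(\<Prod>i\<in>insert a A. f i) = f a * h"
    using insert by (simp add: h_def)
  have "coprime (f a) h"
    unfolding h_def using insert.hyps insert.prems by (intro prod_coprime_right) (metis insertCI)
  then obtain u v where uv: "u * f a + v * h = 1"
    by (metis bezout_coefficients_fst_snd coprime_iff_gcd_eq_1)
  have split: "y = poly_shift v (poly_shift h y) + poly_shift u (poly_shift (f a) y)" for y
  proof -
    have "poly_shift 1 y = poly_shift u (poly_shift (f a) y) + poly_shift v (poly_shift h y)"
      by (simp add: uv[symmetric] fun_eq_iff poly_shift_add poly_shift_mult)
    then show ?thesis
      by (simp add: add.commute)
  qed
  show ?case
    unfolding is_direct_sum_def prod
  proof (intro conjI allI impI subset_antisym subsetI)
    fix y assume "y \<in> recurrence_space (f a * h)"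
    let ?x = "poly_shift v (poly_shift h y)" and ?z = "poly_shift u (poly_shift (f a) y)"
    have "poly_shift (f a * h) y = 0" "poly_shift (h * f a) y = 0"
      using \<open>y \<in> recurrence_space (f a * h)\<close>
      by (simp_all only: recurrence_space_def mem_Collect_eq mult.commute[of h])
    then have "poly_shift h y \<in> ?R a" "poly_shift (f a) y \<in> recurrence_space h"
      by (simp_all only: recurrence_space_def mem_Collect_eq poly_shift_mult)
    then have x: "?x \<in> ?R a" and z: "?z \<in> recurrence_space h"
      by (simp_all only: recurrence_space_invariant)
    then obtain w where w: "?z = (\<Sum>i\<in>A. w i)" "\<forall>i\<in>A. w i \<in> ?R i"
      using IH unfolding is_direct_sum_def by blast
    let ?w = "w(a := ?x)"
    have "(\<Sum>i\<in>A. ?w i) = (\<Sum>i\<in>A. w i)"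
      using insert by (intro sum.cong) auto
    then have "(\<Sum>i\<in>insert a A. ?w i) = ?x + ?z"
      using insert.hyps w(1) by (simp only: sum.insert fun_upd_same not_False_eq_True)
    then have "y = (\<Sum>i\<in>insert a A. ?w i)"
      using split[of y] by metis
    moreover have "\<forall>i\<in>insert a A. ?w i \<in> ?R i"
      using w(2) x by simp
    ultimately show "y \<in> {(\<Sum>i\<in>insert a A. w i) | w. \<forall>i\<in>insert a A. w i \<in> ?R i}"
      by blast
  next
    fix y assume "y \<in> {(\<Sum>i\<in>insert a A. w i) | w. \<forall>i\<in>insert a A. w i \<in> ?R i}"
    then obtain w where y: "y = (\<Sum>i\<in>insert a A. w i)" and w: "\<forall>i\<in>insert a A. w i \<in> ?R i"
      by blast
    have "poly_shift (f a * h) (w i) = 0" if "i \<in> insert a A" for i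
    proof -
      have "f i dvd f a * h"
        using that insert.hyps by (metis dvd_prodI finite_insert prod)
      then have "w i \<in> recurrence_space (f a * h)"
        using w that recurrence_space_mono by blast
      then show ?thesis
        by (simp only: recurrence_space_def mem_Collect_eq)
    qed
    then show "y \<in> recurrence_space (f a * h)"
      by (simp only: recurrence_space_def mem_Collect_eq y poly_shift_sum_right sum.neutral_const
          cong: sum.cong)
  next
    fix w assume w: "(\<forall>i\<in>insert a A. w i \<in> ?R i) \<and> (\<Sum>i\<in>insert a A. w i) = 0"
    have sum_in: "(\<Sum>i\<in>A. w i) \<in> recurrence_space h"
      using IH w unfolding is_direct_sum_def by blast
    have eq: "w a + (\<Sum>i\<in>A. w i) = 0"
      using w insert by simp
    have "poly_shift h (w a) = 0"
      using sum_in poly_shift_add_right[of h "w a" "\<Sum>i\<in>A. w i"]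
      by (simp add: eq recurrence_space_def)
    moreover have "poly_shift (f a) (w a) = 0"
      using w by (simp add: recurrence_space_def)
    ultimately have wa: "w a = 0"
      using split[of "w a"] by simp
    then have "(\<Sum>i\<in>A. w i) = 0"
      using eq by simp
    then have "\<forall>i\<in>A. w i = 0"
      using IH w unfolding is_direct_sum_def by blast
    with wa show "\<forall>i\<in>insert a A. w i = 0"
      by simp
  qed
qed

lemma is_direct_sum_cong:
  assumes "\<And>i. i \<in> I \<Longrightarrow> W i = W' i"
  shows "is_direct_sum I W V \<longleftrightarrow> is_direct_sum I W' V"
proof -
  have "(\<forall>i\<in>I. w i \<in> W i) \<longleftrightarrow> (\<forall>i\<in>I. w i \<in> W' i)" for w
    using assms by auto
  then show ?thesis
    by (simp only: is_direct_sum_def)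
qed

lemma is_direct_sum_reindex:
  fixes W :: "'i \<Rightarrow> cseq set" and \<sigma> :: "'j \<Rightarrow> 'i"
  assumes \<sigma>: "bij_betw \<sigma> J I" and sum: "is_direct_sum I W V"
  shows "is_direct_sum J (\<lambda>j. W (\<sigma> j)) V"
proof -
  define \<tau> where "\<tau> = inv_into J \<sigma>"
  have \<tau>: "\<tau> i \<in> J" "\<sigma> (\<tau> i) = i" if "i \<in> I" for i
    using that \<sigma> bij_betw_inv_into_right[OF \<sigma>] bij_betwE[OF bij_betw_inv_into[OF \<sigma>]]
    by (auto simp: \<tau>_def)
  have \<sigma>\<tau>: "\<sigma> j \<in> I" "\<tau> (\<sigma> j) = j" if "j \<in> J" for j
    using that \<sigma> by (auto simp: \<tau>_def bij_betw_inv_into_left bij_betwE)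
  have push: "(\<Sum>j\<in>J. w (\<sigma> j)) = (\<Sum>i\<in>I. w i)" for w :: "'i \<Rightarrow> cseq"
    by (rule sum.reindex_bij_betw[OF \<sigma>])
  have pull: "(\<Sum>i\<in>I. w (\<tau> i)) = (\<Sum>j\<in>J. w j)" for w :: "'j \<Rightarrow> cseq"
    unfolding push[symmetric] using \<sigma>\<tau> by (intro sum.cong) auto
  have V: "V = {(\<Sum>i\<in>I. w i) | w. \<forall>i\<in>I. w i \<in> W i}"
    and direct: "\<And>w. \<forall>i\<in>I. w i \<in> W i \<Longrightarrow> (\<Sum>i\<in>I. w i) = 0 \<Longrightarrow> \<forall>i\<in>I. w i = 0"
    using sum unfolding is_direct_sum_def by blast+
  show ?thesis
    unfolding is_direct_sum_def
  proof (intro conjI allI impI subset_antisym subsetI)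
    fix y assume "y \<in> V"
    then obtain w where "y = (\<Sum>i\<in>I. w i)" "\<forall>i\<in>I. w i \<in> W i"
      unfolding V by blast
    then show "y \<in> {(\<Sum>j\<in>J. w j) | w. \<forall>j\<in>J. w j \<in> W (\<sigma> j)}"
      using \<sigma>\<tau> by (auto simp: push intro!: exI[of _ "\<lambda>j. w (\<sigma> j)"])
  next
    fix y assume "y \<in> {(\<Sum>j\<in>J. w j) | w. \<forall>j\<in>J. w j \<in> W (\<sigma> j)}"
    then obtain w where w: "y = (\<Sum>j\<in>J. w j)" "\<forall>j\<in>J. w j \<in> W (\<sigma> j)"
      by blast
    then have "\<forall>i\<in>I. w (\<tau> i) \<in> W i"
      using \<tau> by metis
    then show "y \<in> V"
      unfolding V using w(1) pull[of w] by (auto intro!: exI[of _ "\<lambda>i. w (\<tau> i)"])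
  next
    fix w assume w: "(\<forall>j\<in>J. w j \<in> W (\<sigma> j)) \<and> (\<Sum>j\<in>J. w j) = 0"
    then have "\<forall>i\<in>I. w (\<tau> i) \<in> W i"
      using \<tau> by metis
    then have "\<forall>i\<in>I. w (\<tau> i) = 0"
      using direct[of "\<lambda>i. w (\<tau> i)"] w by (simp add: pull)
    then show "\<forall>j\<in>J. w j = 0"
      using \<sigma>\<tau> by metis
  qed
qed

text \<open>
  By the fundamental theorem of algebra a monic \<open>p\<close> is the product of the powers of its root
  factors.  The components belong to the distinct roots, with the multiplicities as exponents.
\<close>

lemma recurrence_space_direct_sum_G:
  assumes "lead_coeff p = 1"
  shows "\<exists>(s::nat) (lam :: nat \<Rightarrow> complex) (l :: nat \<Rightarrow> nat).
    (\<forall>i\<in>{1..s}. 0 < l i) \<and> is_direct_sum {1..s} (\<lambda>i. G (lam i) (l i)) (recurrence_space p)"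
proof -
  have p0: "p \<noteq> 0"
    using assms by auto
  define A where "A = {a. poly p a = 0}"
  have fin: "finite A"
    unfolding A_def by (rule poly_roots_finite[OF p0])
  have pos: "0 < order a p" if "a \<in> A" for a
    using that p0 by (simp add: A_def order_gt_0_iff)
  have "(\<Prod>a\<in>A. [:- a, 1:] ^ order a p) = p"
    using complex_poly_decompose[of p] assms by (simp add: A_def)
  then have "is_direct_sum A (\<lambda>a. recurrence_space ([:- a, 1:] ^ order a p)) (recurrence_space p)"
    using recurrence_space_prod_direct_sum[OF fin, of "\<lambda>a. [:- a, 1:] ^ order a p"]
      coprime_linear_powers by auto
  moreover obtain lam where lam: "bij_betw lam {1..card A} A"
    using ex_bij_betw_nat_finite_1[OF fin] by blast
  ultimately have sum: "is_direct_sum {1..card A}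
      (\<lambda>i. recurrence_space ([:- lam i, 1:] ^ order (lam i) p)) (recurrence_space p)"
    using is_direct_sum_reindex by blast
  have pos': "0 < order (lam i) p" if "i \<in> {1..card A}" for i
    using that pos lam bij_betwE by blast
  have "is_direct_sum {1..card A} (\<lambda>i. G (lam i) (order (lam i) p)) (recurrence_space p)"
    using sum pos' by (subst is_direct_sum_cong[OF G_eq_recurrence_space]) auto
  with pos' show ?thesis
    by (intro exI[of _ "card A"] exI[of _ lam] exI[of _ "\<lambda>i. order (lam i) p"]) blast
qed

section \<open>Shift-invariant spaces\<close>

text \<open>
  Suppose that only the zero sequence in the span of \<open>B\<close> vanishes below \<open>d\<close>.  In the span of
  \<open>insert b B\<close>, the sequences vanishing below \<open>d\<close> then form a space of dimension at most one.
  If this is the line through some \<open>z\<close>, it suffices to go beyond an index at which \<open>z\<close> does not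
  vanish.
\<close>

lemma finite_span_initial_values_injective:
  assumes "finite B"
  shows "\<exists>d. \<forall>y\<in>cseq.span B. (\<forall>i<d. y i = 0) \<longrightarrow> y = 0"
  using assms
proof (induction B rule: finite_induct)
  case (insert b B)
  then obtain d where d: "\<And>y. y \<in> cseq.span B \<Longrightarrow> \<forall>i<d. y i = 0 \<Longrightarrow> y = 0"
    by blast
  show ?case
  proof (cases "\<exists>z\<in>cseq.span (insert b B). (\<forall>i<d. z i = 0) \<and> z \<noteq> 0")
    case True
    then obtain z n where z: "z \<in> cseq.span (insert b B)" "\<forall>i<d. z i = 0" and n: "z n \<noteq> 0"
      by (auto simp: fun_eq_iff)
    obtain k where k: "z - cscale k b \<in> cseq.span B"
      using z(1) cseq.span_breakdown_eq by blast
    have "k \<noteq> 0"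
    proof
      assume "k = 0"
      then have "z = 0"
        using k z(2) d by simp
      with n show False
        by simp
    qed
    have "y = 0" if y: "y \<in> cseq.span (insert b B)" "\<forall>i<max d (Suc n). y i = 0" for y
    proof -
      obtain c where c: "y - cscale c b \<in> cseq.span B"
        using y(1) cseq.span_breakdown_eq by blast
      let ?x = "y - cscale (c / k) z"
      have "?x = (y - cscale c b) - cscale (c / k) (z - cscale k b)"
        using \<open>k \<noteq> 0\<close> by (simp add: fun_eq_iff cscale_def field_simps)
      then have "?x \<in> cseq.span B"
        using c k by (metis cseq.span_diff cseq.span_scale)
      moreover have "\<forall>i<d. ?x i = 0"
        using y(2) z(2) by (simp add: cscale_def)
      ultimately have "?x = 0"
        by (rule d)
      then have yz: "y = cscale (c / k) z"
        by simp
      then have "c / k * z n = 0"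
        using y(2) by (simp add: cscale_def)
      then have "c / k = 0"
        using n by simp
      with yz show "y = 0"
        by simp
    qed
    then show ?thesis
      by blast
  qed blast
qed auto

text \<open>
  The recurrence is read off from the members \<open>b j\<close> of \<open>V\<close> whose initial values form the standard
  basis: since each \<open>y \<in> V\<close> is the sum of the \<open>b j\<close> with coefficients \<open>y j\<close>, its term at \<open>d\<close> is
  \<open>\<Sum>j<d. y j * b j d\<close>.
\<close>

lemma shift_invariant_eq_recurrence_space:
  assumes V: "cseq.subspace V" "fin_dim V" and inv: "\<And>y. y \<in> V \<Longrightarrow> shift y \<in> V"
  obtains p where "lead_coeff p = 1" "V = recurrence_space p"
proof -
  define inj where "inj d \<longleftrightarrow> (\<forall>y\<in>V. (\<forall>i<d. y i = 0) \<longrightarrow> y = 0)" for d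
  define d where "d = (LEAST d. inj d)"
  obtain B where B: "finite B" "V \<subseteq> cseq.span B"
    using V(2) unfolding fin_dim_def by blast
  obtain d' where "\<forall>y\<in>cseq.span B. (\<forall>i<d'. y i = 0) \<longrightarrow> y = 0"
    using finite_span_initial_values_injective[OF B(1)] by blast
  then have "inj d'"
    using B(2) unfolding inj_def by (meson subsetD)
  then have "inj d"
    unfolding d_def by (rule LeastI)
  then have zero: "y = 0" if "y \<in> V" "\<forall>i<d. y i = 0" for y
    using that by (simp add: inj_def)
  have echelon: "\<exists>v\<in>V. (\<forall>i<j. v i = 0) \<and> v j \<noteq> 0" if "j < d" for j
  proof (rule ccontr)
    assume no: "\<not> ?thesis"
    \<comment> \<open>Vanishing below \<open>j\<close> forces vanishing at \<open>j\<close> and so passes on to the shifted sequence.\<close>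
    have "y n = 0" if "y \<in> V" "\<forall>i<j. y i = 0" for y n
      using that
    proof (induction n arbitrary: y)
      case 0
      then show ?case
        using no by (cases j) auto
    next
      case (Suc n)
      then have "y j = 0"
        using no by blast
      then have "\<forall>i<j. shift y i = 0"
        using Suc.prems(2) by (metis Suc_lessI shift_def)
      then have "shift y n = 0"
        using Suc inv by blast
      then show ?case
        by (simp add: shift_def)
    qed
    then have "inj j"
      by (auto simp: inj_def fun_eq_iff)
    then show False
      using that not_less_Least unfolding d_def by blast
  qed
  have "\<exists>y\<in>V. \<forall>i<d. y i = (if i = j then 1 else 0)" for j
    using initial_values_surjective[OF V(1) echelon] .
  then obtain b where b: "\<And>j. b j \<in> V" "\<And>j i. i < d \<Longrightarrow> b j i = (if i = j then 1 else 0)"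
    by metis
  have expand: "y = (\<Sum>j<d. cscale (y j) (b j))" if "y \<in> V" for y
  proof -
    have "y - (\<Sum>j<d. cscale (y j) (b j)) = 0"
    proof (rule zero)
      show "y - (\<Sum>j<d. cscale (y j) (b j)) \<in> V"
        using that b(1) V(1) by (intro cseq.subspace_diff cseq.subspace_sum cseq.subspace_scale)
      show "\<forall>i<d. (y - (\<Sum>j<d. cscale (y j) (b j))) i = 0"
        by (simp add: sum_cseq_apply cscale_def b(2) if_distrib cong: if_cong)
    qed
    then show ?thesis
      by simp
  qed
  define p where "p = monom 1 d - (\<Sum>j<d. monom (b j d) j)"
  have coeff: "coeff p k = (if k = d then 1 else if k < d then - b k d else 0)" for k
    by (auto simp: p_def coeff_sum)
  have deg: "degree p = d"
    by (intro antisym degree_le le_degree) (auto simp: coeff)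
  have lead: "lead_coeff p = 1"
    by (simp add: deg coeff)
  have funpow_inv: "(shift ^^ n) y \<in> V" if "y \<in> V" for y n
    using that inv by (induction n) auto
  have "V \<subseteq> recurrence_space p"
  proof
    fix y assume "y \<in> V"
    have "poly_shift p y n = 0" for n
    proof -
      have "(\<lambda>i. y (i + n)) \<in> V"
        using funpow_inv[OF \<open>y \<in> V\<close>, of n] by (simp add: funpow_shift)
      from fun_cong[OF expand[OF this], of d]
      have "y (d + n) = (\<Sum>j<d. y (j + n) * b j d)"
        by (simp add: sum_cseq_apply cscale_def)
      then show ?thesis
        by (simp add: poly_shift_apply deg coeff lessThan_Suc_atMost[symmetric] sum_negf
            algebra_simps)
    qed
    then show "y \<in> recurrence_space p"
      by (simp add: recurrence_space_def fun_eq_iff)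
  qed
  then have "V = recurrence_space p"
    using lead echelon V(1) deg by (intro subspace_eq_recurrence_space) auto
  with lead that show thesis
    by blast
qed

lemma direct_sum_G_invariant:
  assumes "\<forall>i\<in>I. 0 < l i" and sum: "is_direct_sum I (\<lambda>i. G (lam i) (l i)) V"
  shows "invariant_under (poly_shift q) V"
proof -
  have V: "V = {(\<Sum>i\<in>I. w i) | w. \<forall>i\<in>I. w i \<in> G (lam i) (l i)}"
    using sum unfolding is_direct_sum_def by blast
  have "poly_shift q y \<in> V" if "y \<in> V" for y
  proof -
    from that obtain w where y: "y = (\<Sum>i\<in>I. w i)" and w: "\<forall>i\<in>I. w i \<in> G (lam i) (l i)"
      unfolding V by blast
    have "\<forall>i\<in>I. poly_shift q (w i) \<in> G (lam i) (l i)"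
      using w assms(1) by (simp add: G_eq_recurrence_space recurrence_space_invariant)
    then show ?thesis
      unfolding V y poly_shift_sum_right by (intro CollectI exI[of _ "\<lambda>i. poly_shift q (w i)"]) simp
  qed
  then show ?thesis
    by (auto simp: invariant_under_def)
qed

theorem theorem3:
  fixes V :: "cseq set"
  assumes "cseq.subspace V" and "fin_dim V"
  shows "(\<forall>T. finite_difference_operator T \<longrightarrow> invariant_under T V) \<longleftrightarrow>
    (\<exists>(s::nat) (lam :: nat \<Rightarrow> complex) (l :: nat \<Rightarrow> nat).
       (\<forall>i\<in>{1..s}. 0 < l i) \<and> is_direct_sum {1..s} (\<lambda>i. G (lam i) (l i)) V)"
proof
  assume inv: "\<forall>T. finite_difference_operator T \<longrightarrow> invariant_under T V"
  have "shift = poly_shift [:0, 1:]"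
    by (simp add: fun_eq_iff shift_def poly_shift_pCons)
  then have "invariant_under shift V"
    using inv by (auto simp: finite_difference_operator_def)
  then have "\<And>y. y \<in> V \<Longrightarrow> shift y \<in> V"
    by (auto simp: invariant_under_def)
  then obtain p where "lead_coeff p = 1" "V = recurrence_space p"
    using shift_invariant_eq_recurrence_space[OF assms] by blast
  then show "\<exists>(s::nat) (lam :: nat \<Rightarrow> complex) (l :: nat \<Rightarrow> nat).
      (\<forall>i\<in>{1..s}. 0 < l i) \<and> is_direct_sum {1..s} (\<lambda>i. G (lam i) (l i)) V"
    using recurrence_space_direct_sum_G by simp
next
  assume "\<exists>(s::nat) (lam :: nat \<Rightarrow> complex) (l :: nat \<Rightarrow> nat).
      (\<forall>i\<in>{1..s}. 0 < l i) \<and> is_direct_sum {1..s} (\<lambda>i. G (lam i) (l i)) V"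
  then show "\<forall>T. finite_difference_operator T \<longrightarrow> invariant_under T V"
    using direct_sum_G_invariant by (auto simp: finite_difference_operator_def)
qed

end
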